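(* Let $(X,d_X)$ and $(Y,d_Y)$ be unbounded chain-connected proper metric spaces. Suppose $T:\mathcal{SO}(X)\to\mathcal{SO}(Y)$ is a lattice isomorphism with $T(0)=0$. Then the homeomorphism $\tau:X\to Y$ induced by $T$ is a coarse homeomorphism. The same conclusion holds for lattice isomorphisms $T:\mathcal{SO}^{\ast}(X)\to\mathcal{SO}^{\ast}(Y)$ with $T(0)=0$.
   Context: A metric space is proper if all its closed balls are compact. For $r>0$, $X$ is $r$-chain connected if for any $x,x'\in X$ there are finitely many points $p_0=x,p_1,\dots,p_n=x'$ in $X$ with $d_X(p_{i-1},p_i)\le r$ for $i=1,\dots,n$; $X$ is chain-connected if it is $r$-chain connected for some $r>0$. A continuous $f:X\to\mathbb{R}$ on a proper metric space is slowly oscillating if for every $R>0$ and $\varepsilon>0$ there is a compact $K\subset X$ with $\operatorname{diam} f(B_{d_X}(x,R))<\varepsilon$ for every $x\in X\setminus K$, where $B_{d_X}(x,R)$ is the closed ball. $\mathcal{SO}(X)$ is the lattice (pointwise $\wedge=\min$, $\vee=\max$) of all continuous slowly oscillating functions $X\to\mathbb{R}$ and $\mathcal{SO}^{\ast}(X)$ the sublattice of bounded ones. A lattice isomorphism is a bijection preserving $\vee$ and $\wedge$ (not assumed linear). For $A(X)$ equal to $\mathcal{SO}(X)$ or $\mathcal{SO}^{\ast}(X)$, a homeomorphism $\tau:X\to Y$ is induced by a lattice isomorphism $T:A(X)\to A(Y)$ if for all $f,g\in A(X)$ and every open $U\subset X$: $f\ge g$ on $U$ iff $T(f)\ge T(g)$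 on $\tau(U)$; such a $\tau$ exists and is unique, and it satisfies: $T(f)(y)=T(g)(y)$ iff $f(\tau^{-1}(y))=g(\tau^{-1}(y))$, for all $f,g\in A(X)$, $y\in Y$. A map $f:X\to Y$ is uniformly expansive if there is a non-decreasing $\sigma:[0,\infty)\to[0,\infty)$ with $d_Y(f(x),f(x'))\le\sigma(d_X(x,x'))$ for all $x,x'\in X$; metrically proper if preimages of bounded sets are bounded; a coarse map if it is both. A homeomorphism $f$ is a coarse homeomorphism if both $f$ and $f^{-1}$ are coarse maps. *)

theory Defs
  imports "HOL-Analysis.Analysis"
begin

definition proper_space :: "'a::metric_space itself \<Rightarrow> bool" where
  "proper_space _ \<longleftrightarrow> (\<forall>(x::'a) r. compact (cball x r))"

definition r_chain_connected :: "'a::metric_space itself \<Rightarrow> real \<Rightarrow> bool" where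
  "r_chain_connected _ r \<longleftrightarrow>
     (\<forall>x x'::'a. \<exists>(n::nat) (p::nat \<Rightarrow> 'a).
        p 0 = x \<and> p n = x' \<and> (\<forall>i\<in>{1..n}. dist (p (i - 1)) (p i) \<le> r))"

definition chain_connected :: "'a::metric_space itself \<Rightarrow> bool" where
  "chain_connected X \<longleftrightarrow> (\<exists>r>0. r_chain_connected X r)"

text \<open>
  Only meant for proper spaces: there the image of a closed ball under a continuous function is
  bounded, so the library's \<open>diameter\<close>, a real supremum, has its usual meaning.
\<close>
definition slowly_oscillating :: "('a::metric_space \<Rightarrow> real) \<Rightarrow> bool" where
  "slowly_oscillating f \<longleftrightarrow> continuous_on UNIV f \<and>
     (\<forall>R>0. \<forall>\<epsilon>>0. \<exists>K. compact K \<and> (\<forall>x. x \<notin> K \<longrightarrow> diameter (f ` cball x R) < \<epsilon>))"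

definition SO :: "('a::metric_space \<Rightarrow> real) set" where
  "SO = {f. slowly_oscillating f}"

definition SO_bdd :: "('a::metric_space \<Rightarrow> real) set" where
  "SO_bdd = {f. slowly_oscillating f \<and> bounded (range f)}"

text \<open>
  On real-valued functions \<open>sup\<close> and \<open>inf\<close> are the pointwise maximum and minimum.
  The values of \<open>T\<close> outside \<open>A\<close> are irrelevant.
\<close>
definition lattice_isomorphism :: "'f::lattice set \<Rightarrow> 'g::lattice set \<Rightarrow> ('f \<Rightarrow> 'g) \<Rightarrow> bool" where
  "lattice_isomorphism A B T \<longleftrightarrow> bij_betw T A B \<and>
     (\<forall>f\<in>A. \<forall>g\<in>A. T (sup f g) = sup (T f) (T g) \<and> T (inf f g) = inf (T f) (T g))"

definition induced_homeomorphism ::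
  "('a::metric_space \<Rightarrow> real) set \<Rightarrow> (('a \<Rightarrow> real) \<Rightarrow> ('b::metric_space \<Rightarrow> real)) \<Rightarrow> ('a \<Rightarrow> 'b) \<Rightarrow> bool"
  where
  "induced_homeomorphism A T \<tau> \<longleftrightarrow> homeomorphism UNIV UNIV \<tau> (inv \<tau>) \<and>
     (\<forall>f\<in>A. \<forall>g\<in>A. \<forall>U. open U \<longrightarrow>
        ((\<forall>x\<in>U. f x \<ge> g x) \<longleftrightarrow> (\<forall>y\<in>\<tau> ` U. T f y \<ge> T g y)))"

definition uniformly_expansive :: "('a::metric_space \<Rightarrow> 'b::metric_space) \<Rightarrow> bool" where
  "uniformly_expansive f \<longleftrightarrow>
     (\<exists>\<sigma>::real \<Rightarrow> real. mono_on {0..} \<sigma> \<and> \<sigma> ` {0..} \<subseteq> {0..} \<and>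
        (\<forall>x x'. dist (f x) (f x') \<le> \<sigma> (dist x x')))"

definition metrically_proper :: "('a::metric_space \<Rightarrow> 'b::metric_space) \<Rightarrow> bool" where
  "metrically_proper f \<longleftrightarrow> (\<forall>B. bounded B \<longrightarrow> bounded (f -` B))"

definition coarse_map :: "('a::metric_space \<Rightarrow> 'b::metric_space) \<Rightarrow> bool" where
  "coarse_map f \<longleftrightarrow> uniformly_expansive f \<and> metrically_proper f"

definition coarse_homeomorphism :: "('a::metric_space \<Rightarrow> 'b::metric_space) \<Rightarrow> bool" where
  "coarse_homeomorphism f \<longleftrightarrow>
     homeomorphism UNIV UNIV f (inv f) \<and> coarse_map f \<and> coarse_map (inv f)"

end

theory Submission imports Defs begin

text \<open>
  The proof rests on three properties of \<open>T\<close>: it is a bijection, it fixes \<open>0\<close>, and it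
  transports the order on every open set along \<open>\<tau>\<close>. Bounded and unbounded functions are treated
  together, as any class \<open>A\<close> with \<open>SO_bdd \<subseteq> A \<subseteq> SO\<close>. As \<open>\<tau>\<close> is a homeomorphism of proper spaces,
  it is metrically proper in both directions, and the hypotheses are symmetric under passing to the
  inverses. So it suffices to show that \<open>\<tau>\<close> is uniformly expansive.

  Suppose it is not: there are points \<open>x n, x' n\<close> at distance at most \<open>R\<close> whose images \<open>y n, y' n\<close>
  drift apart. By compactness both sequences go to infinity. A function \<open>g\<close> on the target that is
  large at every \<open>y n\<close> and \<open>0\<close> at every \<open>y' n\<close> can then be slowly oscillating, because there
  is more and more room to come down, and the preimage \<open>f\<close> of \<open>g\<close> vanishes at \<open>x' n\<close>. This
  contradicts the slow oscillation of \<open>f\<close> as long as \<open>f (x n)\<close> stays away from \<open>0\<close>. Since \<open>T\<close> is not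
  linear this is not automatic; it is ensured if \<open>g\<close> dominates \<open>T c\<close> at the points \<open>y n\<close> for some
  constant \<open>c > 0\<close>, and a bounded \<open>g\<close> can do that if \<open>T c\<close> is bounded above.

  That some \<open>T c\<close> is bounded above is where chain connectedness is used
  (\<open>image_of_small_constant_bounded\<close>). Otherwise there are points \<open>x n\<close> going to infinity with
  \<open>T (1 / (n + 1)) \<ge> 1\<close> at \<open>\<tau> (x n)\<close>. Chain connectedness provides points \<open>z n \<noteq> \<tau> (x n)\<close>
  within a fixed distance of \<open>\<tau> (x n)\<close>. A continuous function that tends to \<open>0\<close> at infinity is slowly
  oscillating whatever it does locally, so some \<open>f\<close> in \<open>SO_bdd\<close> is at least \<open>1 / (n + 1)\<close> near \<open>x n\<close> and
  vanishes near the preimages of the \<open>z n\<close>. But then \<open>T f\<close> is at least \<open>1\<close> at \<open>\<tau> (x n)\<close> and \<open>0\<close> at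
  \<open>z n\<close>, so \<open>T f\<close> is not slowly oscillating.

  Both test functions are suprema of sequences of bumps (\<open>separating_function\<close>).
\<close>

section \<open>Slowly oscillating functions\<close>

lemma slowly_oscillating_iff:
  fixes f :: "'a::metric_space \<Rightarrow> real"
  assumes proper: "proper_space TYPE('a)"
  shows "slowly_oscillating f \<longleftrightarrow> continuous_on UNIV f \<and>
    (\<forall>R>0. \<forall>\<epsilon>>0. \<exists>K. compact K \<and>
       (\<forall>x x'. x \<notin> K \<longrightarrow> dist x x' \<le> R \<longrightarrow> \<bar>f x - f x'\<bar> < \<epsilon>))" (is "_ \<longleftrightarrow> ?rhs")
proof
  assume so: "slowly_oscillating f"
  then have cont: "continuous_on UNIV f"
    by (simp add: slowly_oscillating_def)
  have "\<exists>K. compact K \<and> (\<forall>x x'. x \<notin> K \<longrightarrow> dist x x' \<le> R \<longrightarrow> \<bar>f x - f x'\<bar> < \<epsilon>)"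
    if "R > 0" "\<epsilon> > 0" for R \<epsilon>
  proof -
    obtain K where K: "compact K" "\<And>x. x \<notin> K \<Longrightarrow> diameter (f ` cball x R) < \<epsilon>"
      using so \<open>R > 0\<close> \<open>\<epsilon> > 0\<close> unfolding slowly_oscillating_def by blast
    have "\<bar>f x - f x'\<bar> < \<epsilon>" if "x \<notin> K" "dist x x' \<le> R" for x x'
    proof -
      have "compact (f ` cball x R)"
        using proper continuous_on_subset[OF cont]
        by (intro compact_continuous_image) (auto simp: proper_space_def)
      then have "dist (f x) (f x') \<le> diameter (f ` cball x R)"
        using that \<open>R > 0\<close>
        by (intro diameter_bounded_bound compact_imp_bounded) auto
      then show ?thesis
        using K(2)[OF \<open>x \<notin> K\<close>] by (simp add: dist_real_def)
    qed
    with K(1) show ?thesis by blast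
  qed
  with cont show ?rhs by blast
next
  assume rhs: ?rhs
  have "\<exists>K. compact K \<and> (\<forall>x. x \<notin> K \<longrightarrow> diameter (f ` cball x R) < \<epsilon>)"
    if "R > 0" "\<epsilon> > 0" for R \<epsilon>
  proof -
    \<comment> \<open>Two points of the ball are compared through its centre, and the supremum may be attained.\<close>
    have "\<epsilon> / 3 > 0" using \<open>\<epsilon> > 0\<close> by simp
    then obtain K where K: "compact K"
      "\<And>x x'. x \<notin> K \<Longrightarrow> dist x x' \<le> R \<Longrightarrow> \<bar>f x - f x'\<bar> < \<epsilon> / 3"
      using rhs \<open>R > 0\<close> by blast
    have "diameter (f ` cball x R) < \<epsilon>" if "x \<notin> K" for x
    proof -
      have "dist u v \<le> 2 * (\<epsilon> / 3)" if uv: "u \<in> f ` cball x R" "v \<in> f ` cball x R" for u v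
      proof -
        obtain a b where ab: "u = f a" "v = f b" "dist x a \<le> R" "dist x b \<le> R"
          using uv by auto
        then show ?thesis
          using K(2)[OF \<open>x \<notin> K\<close> ab(3)] K(2)[OF \<open>x \<notin> K\<close> ab(4)]
          unfolding dist_real_def ab(1,2) by linarith
      qed
      then have "diameter (f ` cball x R) \<le> 2 * (\<epsilon> / 3)"
        using \<open>\<epsilon> > 0\<close> by (intro diameter_le) (auto simp: dist_norm)
      then show ?thesis using \<open>\<epsilon> > 0\<close> by simp
    qed
    with K(1) show ?thesis by blast
  qed
  with rhs show "slowly_oscillating f"
    unfolding slowly_oscillating_def by blast
qed

lemma slowly_oscillatingE:
  fixes f :: "'a::metric_space \<Rightarrow> real"
  assumes "proper_space TYPE('a)" "slowly_oscillating f" "R > 0" "\<epsilon> > 0"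
  obtains K where "compact K" "\<And>x x'. x \<notin> K \<Longrightarrow> dist x x' \<le> R \<Longrightarrow> \<bar>f x - f x'\<bar> < \<epsilon>"
  using assms slowly_oscillating_iff by metis

lemma constant_in_SO_bdd: "(\<lambda>_. c) \<in> SO_bdd"
proof -
  have "diameter ((\<lambda>_. c) ` cball x R) \<le> 0" for x :: 'a and R
    by (rule diameter_le) auto
  then have "slowly_oscillating (\<lambda>_::'a. c)"
    unfolding slowly_oscillating_def by (metis compact_empty continuous_on_const le_less_trans)
  moreover have "bounded (range (\<lambda>_::'a. c))"
    by (rule finite_imp_bounded) auto
  ultimately show ?thesis by (simp add: SO_bdd_def)
qed

lemma slowly_oscillating_if_zero_far_away:
  fixes f :: "'a::metric_space \<Rightarrow> real"
  assumes proper: "proper_space TYPE('a)" and cont: "continuous_on UNIV f"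
    and zero: "\<And>x. dist p x \<ge> s \<Longrightarrow> f x = 0"
  shows "slowly_oscillating f"
proof -
  have "compact (cball p (s + R)) \<and>
      (\<forall>x x'. x \<notin> cball p (s + R) \<longrightarrow> dist x x' \<le> R \<longrightarrow> \<bar>f x - f x'\<bar> < \<epsilon>)"
    if "R > 0" "\<epsilon> > 0" for R \<epsilon>
  proof -
    have "f x = 0 \<and> f x' = 0" if "x \<notin> cball p (s + R)" "dist x x' \<le> R" for x x'
    proof -
      have "dist p x \<le> dist p x' + dist x x'"
        by (metis dist_commute dist_triangle)
      with that \<open>R > 0\<close> show ?thesis by (intro conjI zero) auto
    qed
    then show ?thesis using proper \<open>\<epsilon> > 0\<close> by (auto simp: proper_space_def)
  qed
  then show ?thesis
    unfolding slowly_oscillating_iff[OF proper] using cont by blast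
qed

lemma abs_SUP_diff_le:
  fixes u v :: "nat \<Rightarrow> real"
  assumes "bdd_above (range u)" "bdd_above (range v)" "\<And>n. \<bar>u n - v n\<bar> \<le> \<epsilon>"
  shows "\<bar>(SUP n. u n) - (SUP n. v n)\<bar> \<le> \<epsilon>"
proof -
  have "(SUP n. u n) \<le> (SUP n. v n) + \<epsilon>"
  proof (rule cSUP_least)
    fix n show "u n \<le> (SUP n. v n) + \<epsilon>"
      using assms(3)[of n] cSUP_upper[OF UNIV_I assms(2), of n] by linarith
  qed simp
  moreover have "(SUP n. v n) \<le> (SUP n. u n) + \<epsilon>"
  proof (rule cSUP_least)
    fix n show "v n \<le> (SUP n. u n) + \<epsilon>"
      using assms(3)[of n] cSUP_upper[OF UNIV_I assms(1), of n] by linarith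
  qed simp
  ultimately show ?thesis by linarith
qed

text \<open>
  A supremum varies no more than its most varying member. If the oscillation of \<open>g n\<close> at
  each fixed scale tends to \<open>0\<close> with \<open>n\<close>, only finitely many members matter for a given \<open>\<epsilon>\<close>;
  this yields continuity as well as slow oscillation.
\<close>
lemma SUP_in_SO_bdd:
  fixes g :: "nat \<Rightarrow> 'a::metric_space \<Rightarrow> real"
  assumes proper: "proper_space TYPE('a)"
    and so: "\<And>n. slowly_oscillating (g n)"
    and nonneg: "\<And>n x. 0 \<le> g n x" and le: "\<And>n x. g n x \<le> C"
    and tail: "\<And>R \<epsilon>. R > 0 \<Longrightarrow> \<epsilon> > 0 \<Longrightarrow>
      \<exists>N. \<forall>n\<ge>N. \<forall>x x'. dist x x' \<le> R \<longrightarrow> \<bar>g n x - g n x'\<bar> \<le> \<epsilon>"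
  shows "(\<lambda>x. SUP n. g n x) \<in> SO_bdd"
proof -
  let ?f = "\<lambda>x. SUP n. g n x"
  have bdd: "bdd_above (range (\<lambda>n. g n x))" for x
    using le by (intro bdd_aboveI2)
  have "isCont ?f x" for x
  proof -
    have "\<forall>\<^sub>F x' in at x. dist (?f x') (?f x) < \<epsilon>" if "\<epsilon> > 0" for \<epsilon>
    proof -
      obtain N where N: "\<forall>n\<ge>N. \<forall>x x'. dist x x' \<le> 1 \<longrightarrow> \<bar>g n x - g n x'\<bar> \<le> \<epsilon> / 2"
        using tail[of 1 "\<epsilon> / 2"] \<open>\<epsilon> > 0\<close> by auto
      have "\<forall>\<^sub>F x' in at x. \<bar>g n x' - g n x\<bar> < \<epsilon> / 2" for n
      proof -
        have "isCont (g n) x"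
          using so[of n] by (simp add: slowly_oscillating_def continuous_on_eq_continuous_at)
        then show ?thesis
          using tendstoD[of "g n" "g n x" "at x" "\<epsilon> / 2"] \<open>\<epsilon> > 0\<close>
          by (simp add: isCont_def dist_real_def)
      qed
      then have "\<forall>\<^sub>F x' in at x. \<forall>n\<in>{..<N}. \<bar>g n x' - g n x\<bar> < \<epsilon> / 2"
        by (intro eventually_ball_finite) auto
      moreover have "\<forall>\<^sub>F x' in at x. dist x' x \<le> 1"
        by (auto simp: eventually_at intro!: exI[of _ 1])
      ultimately show ?thesis
      proof eventually_elim
        case (elim x')
        have "\<bar>g n x' - g n x\<bar> \<le> \<epsilon> / 2" for n
          using elim N by (cases "n < N") (auto simp: less_imp_le)
        from abs_SUP_diff_le[OF bdd bdd this] show ?case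
          using \<open>\<epsilon> > 0\<close> by (simp add: dist_real_def)
      qed
    qed
    then show ?thesis by (simp add: isCont_def tendsto_iff)
  qed
  then have cont: "continuous_on UNIV ?f"
    by (simp add: continuous_on_eq_continuous_at)
  have "\<exists>K. compact K \<and> (\<forall>x x'. x \<notin> K \<longrightarrow> dist x x' \<le> R \<longrightarrow> \<bar>?f x - ?f x'\<bar> < \<epsilon>)"
    if "R > 0" "\<epsilon> > 0" for R \<epsilon>
  proof -
    obtain N where N: "\<forall>n\<ge>N. \<forall>x x'. dist x x' \<le> R \<longrightarrow> \<bar>g n x - g n x'\<bar> \<le> \<epsilon> / 2"
      using tail[of R "\<epsilon> / 2"] \<open>R > 0\<close> \<open>\<epsilon> > 0\<close> half_gt_zero by blast
    have "\<exists>K. compact K \<and> (\<forall>x x'. x \<notin> K \<longrightarrow> dist x x' \<le> R \<longrightarrow> \<bar>g n x - g n x'\<bar> < \<epsilon> / 2)" for n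
      by (rule slowly_oscillatingE[OF proper so[of n], of R "\<epsilon> / 2"]) (use that in auto)
    then obtain K where K: "\<And>n. compact (K n)"
      "\<And>n x x'. x \<notin> K n \<Longrightarrow> dist x x' \<le> R \<Longrightarrow> \<bar>g n x - g n x'\<bar> < \<epsilon> / 2"
      by metis
    have "\<bar>?f x - ?f x'\<bar> < \<epsilon>" if "x \<notin> (\<Union>n<N. K n)" "dist x x' \<le> R" for x x'
    proof -
      have "\<bar>g n x - g n x'\<bar> \<le> \<epsilon> / 2" for n
        using that N K(2)[of x n x'] by (cases "n < N") (auto simp: less_imp_le)
      from abs_SUP_diff_le[OF bdd bdd this] show ?thesis using \<open>\<epsilon> > 0\<close> by simp
    qed
    moreover have "compact (\<Union>n<N. K n)" using K(1) by auto
    ultimately show ?thesis by blast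
  qed
  with cont have "slowly_oscillating ?f"
    unfolding slowly_oscillating_iff[OF proper] by blast
  moreover have "bounded (range ?f)"
  proof -
    have "0 \<le> ?f x \<and> ?f x \<le> C" for x
      using cSUP_upper2[OF bdd, of 0 0 x] nonneg le by (auto intro: cSUP_least)
    then show ?thesis
      by (intro boundedI[of _ C]) auto
  qed
  ultimately show ?thesis by (simp add: SO_bdd_def)
qed

section \<open>Separating two sparse sequences of points\<close>

text \<open>
  The oscillation of the \<open>n\<close>-th bump tends to \<open>0\<close> in either of two cases: its height tends to \<open>0\<close>,
  for arbitrarily narrow bumps, or its width tends to infinity at bounded height.
\<close>
lemma separating_function:
  fixes p q :: "nat \<Rightarrow> 'a::metric_space" and a L :: "nat \<Rightarrow> real"
  assumes proper: "proper_space TYPE('a)"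
    and L_pos: "\<And>n. L n > 0" and a: "\<And>n. 0 \<le> a n" "\<And>n. a n \<le> C"
    and small_osc: "a \<longlonglongrightarrow> 0 \<or> filterlim L at_top sequentially"
    and same: "\<And>n. 3 * L n \<le> dist (p n) (q n)"
    and diff: "\<And>m n. m \<noteq> n \<Longrightarrow> 2 * L m + 1 \<le> dist (p m) (q n)"
  shows "\<exists>f\<in>SO_bdd. (\<forall>n. \<exists>U. open U \<and> p n \<in> U \<and> (\<forall>x\<in>U. f x \<ge> a n)) \<and>
    (\<forall>n. \<exists>U. open U \<and> q n \<in> U \<and> (\<forall>x\<in>U. f x = 0))"
proof -
  define g where "g n x = a n * max 0 (2 - dist (p n) x / L n)" for n x
  have nonneg: "0 \<le> g n x" for n x
    using a(1) by (simp add: g_def)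
  have le2: "g n x \<le> 2 * a n" for n x
    using a(1)[of n] L_pos[of n] mult_left_mono[of "max 0 (2 - dist (p n) x / L n)" 2 "a n"]
    by (simp add: g_def mult.commute)
  then have le: "g n x \<le> 2 * C" for n x
    using a(2)[of n] le2[of n x] by linarith
  have zero: "g n x = 0" if "dist (p n) x \<ge> 2 * L n" for n x
  proof -
    have "dist (p n) x / L n \<ge> 2" using that L_pos[of n] by (simp add: pos_le_divide_eq)
    then show ?thesis by (simp add: g_def)
  qed
  have lipschitz: "\<bar>g n x - g n x'\<bar> \<le> C * (dist x x' / L n)" for n x x'
  proof -
    have "\<bar>dist (p n) x / L n - dist (p n) x' / L n\<bar> \<le> dist x x' / L n"
    proof -
      have "\<bar>dist (p n) x - dist (p n) x'\<bar> \<le> dist x x'"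
        using abs_dist_diff_le[of x "p n" x'] by (simp only: dist_commute)
      then have "\<bar>dist (p n) x - dist (p n) x'\<bar> / L n \<le> dist x x' / L n"
        using L_pos[of n] by (intro divide_right_mono) auto
      also have "\<bar>dist (p n) x - dist (p n) x'\<bar> / L n = \<bar>(dist (p n) x - dist (p n) x') / L n\<bar>"
        using L_pos[of n] by (simp only: abs_div_pos)
      finally show ?thesis by (simp only: diff_divide_distrib)
    qed
    then have "\<bar>max 0 (2 - dist (p n) x / L n) - max 0 (2 - dist (p n) x' / L n)\<bar>
        \<le> dist x x' / L n"
      by linarith
    then have "\<bar>a n\<bar> * \<bar>max 0 (2 - dist (p n) x / L n) - max 0 (2 - dist (p n) x' / L n)\<bar>
        \<le> C * (dist x x' / L n)"
      using a[of n] L_pos[of n] by (intro mult_mono) auto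
    then show ?thesis
      by (simp add: g_def abs_mult[symmetric] right_diff_distrib)
  qed
  have so: "slowly_oscillating (g n)" for n
  proof (rule slowly_oscillating_if_zero_far_away[OF proper])
    show "continuous_on UNIV (g n)"
      unfolding g_def using L_pos[of n] by (intro continuous_intros) auto
  qed (rule zero)
  have tail: "\<exists>N. \<forall>n\<ge>N. \<forall>x x'. dist x x' \<le> R \<longrightarrow> \<bar>g n x - g n x'\<bar> \<le> \<epsilon>"
    if "R > 0" "\<epsilon> > 0" for R \<epsilon>
    using small_osc
  proof
    assume "a \<longlonglongrightarrow> 0"
    then have "\<forall>\<^sub>F n in sequentially. a n < \<epsilon> / 2"
      using \<open>\<epsilon> > 0\<close> by (intro order_tendstoD) auto
    then obtain N where N: "\<forall>n\<ge>N. a n < \<epsilon> / 2"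
      by (auto simp: eventually_sequentially)
    have "\<bar>g n x - g n x'\<bar> \<le> \<epsilon>" if "n \<ge> N" for n x x'
      using N[rule_format, OF that] le2[of n x] le2[of n x'] nonneg[of n x] nonneg[of n x'] by linarith
    then show ?thesis by blast
  next
    assume "filterlim L at_top sequentially"
    then have "\<forall>\<^sub>F n in sequentially. L n \<ge> C * R / \<epsilon>"
      by (simp add: filterlim_at_top)
    then obtain N where N: "\<forall>n\<ge>N. L n \<ge> C * R / \<epsilon>"
      by (auto simp: eventually_sequentially)
    have "\<bar>g n x - g n x'\<bar> \<le> \<epsilon>" if "n \<ge> N" "dist x x' \<le> R" for n x x'
    proof -
      have "C \<ge> 0" using a[of 0] by linarith
      then have "C * (dist x x' / L n) \<le> C * (R / L n)"
        using that L_pos[of n] by (intro mult_left_mono divide_right_mono) auto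
      also have "\<dots> \<le> \<epsilon>"
        using N[rule_format, OF \<open>n \<ge> N\<close>] L_pos[of n] \<open>\<epsilon> > 0\<close> by (simp add: field_simps)
      finally show ?thesis using lipschitz[of n x x'] by linarith
    qed
    then show ?thesis by blast
  qed
  let ?f = "\<lambda>x. SUP n. g n x"
  have mem: "?f \<in> SO_bdd"
    by (rule SUP_in_SO_bdd[OF proper so nonneg le tail])
  have high: "\<exists>U. open U \<and> p n \<in> U \<and> (\<forall>x\<in>U. ?f x \<ge> a n)" for n
  proof (intro exI conjI ballI)
    fix x assume "x \<in> ball (p n) (L n)"
    then have "dist (p n) x / L n \<le> 1" using L_pos[of n] by simp
    then have "a n * 1 \<le> g n x"
      unfolding g_def using a(1) by (intro mult_left_mono) auto
    also have "g n x \<le> ?f x"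
      using le by (intro cSUP_upper bdd_aboveI2) auto
    finally show "a n \<le> ?f x" by simp
  qed (use L_pos in auto)
  have low: "\<exists>U. open U \<and> q n \<in> U \<and> (\<forall>x\<in>U. ?f x = 0)" for n
  proof (intro exI conjI ballI)
    fix x assume x: "x \<in> ball (q n) (min 1 (L n))"
    have "g m x = 0" for m
    proof (rule zero)
      have "dist (p m) (q n) \<le> dist (p m) x + dist (q n) x"
        by (rule dist_triangle2)
      then show "2 * L m \<le> dist (p m) x"
        using x same[of n] diff[of m n] by (cases "m = n") auto
    qed
    then show "?f x = 0" by simp
  qed (use L_pos in auto)
  show ?thesis
    by (intro bexI[OF _ mem] conjI allI high low)
qed

text \<open>
  Pairs that exist arbitrarily far out can be chosen so far apart that bumps of radius
  \<open>2 * (m + 1)\<close> around the first components stay away from the second components of all other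
  pairs.
\<close>
lemma sparse_sequence_of_pairs:
  fixes o1 :: "'a::metric_space"
  assumes far: "\<And>n R. \<exists>p q. P n p q \<and> dist o1 p > R \<and> dist o1 q > R"
  obtains p q :: "nat \<Rightarrow> 'a" where "\<And>n. P n (p n) (q n)" "\<And>n. dist o1 (p n) > real n"
    "\<And>m n. m \<noteq> n \<Longrightarrow> 2 * (real m + 1) + 1 \<le> dist (p m) (q n)"
proof -
  define outer where "outer s = max (dist o1 (fst s)) (dist o1 (snd s))" for s
  define inner where "inner s = min (dist o1 (fst s)) (dist o1 (snd s))" for s
  have far': "\<exists>s. P n (fst s) (snd s) \<and> inner s > R" for n R
    using far[of n R] by (auto simp: inner_def)
  have "\<exists>s. \<forall>n. (P n (fst (s n)) (snd (s n)) \<and> inner (s n) > real n) \<and>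
      inner (s (Suc n)) > outer (s n) + 2 * (real (Suc n) + 1) + 1"
  proof (rule dependent_nat_choice)
    show "\<exists>s. P 0 (fst s) (snd s) \<and> inner s > real 0" using far' by blast
  next
    fix s n
    obtain t where "P (Suc n) (fst t) (snd t)"
      "inner t > max (real (Suc n)) (outer s + 2 * (real (Suc n) + 1) + 1)"
      using far' by blast
    then have "(P (Suc n) (fst t) (snd t) \<and> inner t > real (Suc n)) \<and>
        inner t > outer s + 2 * (real (Suc n) + 1) + 1" by simp
    then show "\<exists>t. (P (Suc n) (fst t) (snd t) \<and> inner t > real (Suc n)) \<and>
        inner t > outer s + 2 * (real (Suc n) + 1) + 1" ..
  qed
  then obtain s where s: "\<And>n. P n (fst (s n)) (snd (s n))" "\<And>n. inner (s n) > real n"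
    "\<And>n. inner (s (Suc n)) > outer (s n) + 2 * (real (Suc n) + 1) + 1" by blast
  have inner_le: "inner t \<le> outer t" for t by (simp add: inner_def outer_def)
  have "outer (s n) \<le> outer (s (Suc n))" for n
    using s(3)[of n] inner_le[of "s (Suc n)"] by simp
  then have mono: "outer (s i) \<le> outer (s j)" if "i \<le> j" for i j
    using that by (rule lift_Suc_mono_le)
  have gap: "inner (s j) \<ge> outer (s i) + 2 * (real j + 1) + 1" if "i < j" for i j
  proof -
    obtain k where k: "j = Suc k" "i \<le> k" using \<open>i < j\<close> by (cases j) auto
    then show ?thesis using mono[OF k(2)] s(3)[of k] by simp
  qed
  show ?thesis
  proof
    show "P n (fst (s n)) (snd (s n))" for n by (rule s)
    show "dist o1 (fst (s n)) > real n" for n using s(2)[of n] by (simp add: inner_def)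
    show "2 * (real m + 1) + 1 \<le> dist (fst (s m)) (snd (s n))" if "m \<noteq> n" for m n
    proof -
      have tri: "\<bar>dist o1 (fst (s m)) - dist o1 (snd (s n))\<bar> \<le> dist (fst (s m)) (snd (s n))"
        using abs_dist_diff_le[of "fst (s m)" o1 "snd (s n)"] by (simp add: dist_commute)
      show ?thesis
      proof (cases "m < n")
        case True
        have "inner (s n) \<le> dist o1 (snd (s n))" "dist o1 (fst (s m)) \<le> outer (s m)"
          by (simp_all add: inner_def outer_def)
        then have "2 * (real n + 1) + 1 \<le> dist (fst (s m)) (snd (s n))"
          using gap[OF True] tri by linarith
        with True show ?thesis by simp
      next
        case False
        then have "n < m" using that by simp
        have "inner (s m) \<le> dist o1 (fst (s m))" "dist o1 (snd (s n)) \<le> outer (s n)"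
          by (simp_all add: inner_def outer_def)
        with gap[OF \<open>n < m\<close>] tri show ?thesis by linarith
      qed
    qed
  qed
qed

section \<open>Large-scale geometry of homeomorphisms between proper spaces\<close>

lemma homeomorphism_imp_metrically_proper:
  fixes \<tau> :: "'a::metric_space \<Rightarrow> 'b::metric_space"
  assumes proper: "proper_space TYPE('b)" and homeo: "homeomorphism UNIV UNIV \<tau> \<tau>'"
  shows "metrically_proper \<tau>"
  unfolding metrically_proper_def
proof (intro allI impI)
  fix B :: "'b set" assume "bounded B"
  then obtain y r where "B \<subseteq> cball y r" by (meson bounded_subset_cball)
  moreover have "x \<in> \<tau>' ` cball y r" if "\<tau> x \<in> cball y r" for x
    using that homeo by (metis UNIV_I homeomorphism_apply1 imageI)
  ultimately have "\<tau> -` B \<subseteq> \<tau>' ` cball y r" by blast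
  moreover have "compact (\<tau>' ` cball y r)"
    using proper continuous_on_subset[OF homeomorphism_cont2[OF homeo]]
    by (intro compact_continuous_image) (auto simp: proper_space_def)
  ultimately show "bounded (\<tau> -` B)"
    by (meson bounded_subset compact_imp_bounded)
qed

lemma metrically_properE:
  assumes "metrically_proper \<tau>"
  obtains D where "\<And>x. dist o2 (\<tau> x) \<le> R \<Longrightarrow> dist o1 x \<le> D"
proof -
  have "bounded (\<tau> -` cball o2 R)"
    using assms by (simp add: metrically_proper_def)
  then obtain D where "\<forall>x\<in>\<tau> -` cball o2 R. dist o1 x \<le> D"
    using bounded_any_center by blast
  then show ?thesis using that[of D] by simp
qed

lemma sequence_to_infinity_leaves_compact:
  assumes proper: "metrically_proper \<tau>" and far: "\<And>n. dist o2 (\<tau> (x n)) > real n"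
    and "continuous_on UNIV \<tau>" "compact K"
  shows "\<exists>n. x n \<notin> K"
proof (rule ccontr)
  assume "\<nexists>n. x n \<notin> K"
  moreover have "bounded (\<tau> ` K)"
    using assms by (meson compact_continuous_image compact_imp_bounded continuous_on_subset subset_UNIV)
  then obtain D where "\<forall>y\<in>\<tau> ` K. dist o2 y \<le> D"
    using bounded_any_center by blast
  ultimately have "real n < D" for n
    using far[of n] by (meson image_eqI less_le_trans)
  then show False
    by (meson reals_Archimedean2 less_asym)
qed

text \<open>The first point of a chain that differs from its starting point is a neighbour of it.\<close>
lemma chain_connected_neighbour:
  fixes y :: "'b::metric_space"
  assumes "r_chain_connected TYPE('b) r" "\<not> bounded (UNIV :: 'b set)"
  obtains z where "z \<noteq> y" "dist y z \<le> r"
proof -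
  obtain y' where "y' \<noteq> y"
    using assms(2) by (metis (full_types) UNIV_eq_I bounded_empty bounded_insert insertI1)
  then obtain n :: nat and p where p: "p 0 = y" "p n = y'" "\<forall>i\<in>{1..n}. dist (p (i - 1)) (p i) \<le> r"
    using assms(1) unfolding r_chain_connected_def by meson
  define i where "i = (LEAST i. p i \<noteq> y)"
  have i: "p i \<noteq> y" "i \<le> n"
    using LeastI[of "\<lambda>i. p i \<noteq> y" n] Least_le[of "\<lambda>i. p i \<noteq> y" n] \<open>y' \<noteq> y\<close> p(2)
    by (auto simp: i_def)
  then have "i \<noteq> 0" using p(1) by metis
  then have "p (i - 1) = y"
    using not_less_Least[of "i - 1" "\<lambda>i. p i \<noteq> y"] by (auto simp: i_def)
  then have "dist y (p i) \<le> r"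
    using p(3) \<open>i \<noteq> 0\<close> i(2) by (metis One_nat_def Suc_leI atLeastAtMost_iff gr0I)
  with i(1) show ?thesis using that by blast
qed

text \<open>The least modulus is the supremum of the distances between images at a given scale.\<close>
lemma uniformly_expansiveI:
  fixes \<tau> :: "'a::metric_space \<Rightarrow> 'b::metric_space"
  assumes "\<And>R. \<exists>M. \<forall>x x'. dist x x' \<le> R \<longrightarrow> dist (\<tau> x) (\<tau> x') \<le> M"
  shows "uniformly_expansive \<tau>"
proof -
  define S where "S R = {dist (\<tau> x) (\<tau> x') |x x'. dist x x' \<le> R}" for R
  have bdd: "bdd_above (S R)" for R
    using assms[of R] by (force simp: S_def bdd_above_def)
  have zero: "0 \<in> S R" if "R \<ge> 0" for R
    using that by (auto simp: S_def intro!: exI[of _ undefined])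
  have "mono_on {0..} (\<lambda>R. Sup (S R))"
  proof (rule mono_onI)
    fix R R' :: real assume "R \<in> {0..}" "R \<le> R'"
    then show "Sup (S R) \<le> Sup (S R')"
      using zero[of R] bdd[of R'] by (intro cSup_subset_mono) (auto simp: S_def intro: order_trans)
  qed
  moreover have "(\<lambda>R. Sup (S R)) ` {0..} \<subseteq> {0..}"
    using zero bdd by (auto intro: cSup_upper)
  moreover have "dist (\<tau> x) (\<tau> x') \<le> Sup (S (dist x x'))" for x x'
    using bdd by (intro cSup_upper) (auto simp: S_def)
  ultimately show ?thesis
    unfolding uniformly_expansive_def by blast
qed

section \<open>Maps that transport the local order of functions\<close>

text \<open>
  These are the properties of a lattice isomorphism and its induced homeomorphism that the
  argument needs. They hold for the inverse maps as well, and keeping \<open>A\<close> and \<open>B\<close> between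
  \<open>SO_bdd\<close> and \<open>SO\<close> covers both function lattices.
\<close>
locale order_transport =
  fixes A :: "('a::metric_space \<Rightarrow> real) set" and B :: "('b::metric_space \<Rightarrow> real) set"
    and T :: "('a \<Rightarrow> real) \<Rightarrow> ('b \<Rightarrow> real)" and \<tau> :: "'a \<Rightarrow> 'b" and \<tau>' :: "'b \<Rightarrow> 'a"
  assumes A: "SO_bdd \<subseteq> A" "A \<subseteq> SO" and B: "SO_bdd \<subseteq> B" "B \<subseteq> SO"
    and bij: "bij_betw T A B" and T_zero: "T (\<lambda>_. 0) = (\<lambda>_. 0)"
    and homeo: "homeomorphism UNIV UNIV \<tau> \<tau>'"
    and order: "\<And>f g U. f \<in> A \<Longrightarrow> g \<in> A \<Longrightarrow> open U \<Longrightarrow>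
      (\<forall>x\<in>U. g x \<le> f x) \<longleftrightarrow> (\<forall>y\<in>\<tau> ` U. T g y \<le> T f y)"
    and proper_a: "proper_space TYPE('a)" and proper_b: "proper_space TYPE('b)"
begin

lemma inverse: "order_transport B A (the_inv_into A T) \<tau>' \<tau>"
proof
  note inj = bij_betw_imp_inj_on[OF bij]
  show "bij_betw (the_inv_into A T) B A"
    by (rule bij_betw_the_inv_into[OF bij])
  have "(\<lambda>_. 0) \<in> A" using A(1) constant_in_SO_bdd by blast
  then show "the_inv_into A T (\<lambda>_. 0) = (\<lambda>_. 0)"
    using the_inv_into_f_f[OF inj] T_zero by metis
  show "homeomorphism UNIV UNIV \<tau>' \<tau>"
    by (rule homeomorphism_symD[OF homeo])
  fix f g U assume fg: "f \<in> B" "g \<in> B" and U: "open (U :: 'b set)"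
  have mem: "the_inv_into A T f \<in> A" "the_inv_into A T g \<in> A"
    using bij_betw_the_inv_into[OF bij] fg by (auto dest: bij_betwE)
  have val: "T (the_inv_into A T f) = f" "T (the_inv_into A T g) = g"
    using f_the_inv_into_f_bij_betw[OF bij] fg by auto
  have img: "\<tau> ` \<tau>' ` U = U"
    using homeomorphism_apply2[OF homeo] by (simp add: image_image)
  have "open (\<tau>' ` U)"
    using homeomorphism_imp_open_map[OF homeomorphism_symD[OF homeo], of U] U by simp
  from order[OF mem this] show "(\<forall>x\<in>U. g x \<le> f x) \<longleftrightarrow>
      (\<forall>y\<in>\<tau>' ` U. the_inv_into A T g y \<le> the_inv_into A T f y)"
    by (simp only: val img)
qed (use A B proper_a proper_b in auto)

lemma \<tau>_\<tau>'[simp]: "\<tau> (\<tau>' y) = y" and \<tau>'_\<tau>[simp]: "\<tau>' (\<tau> x) = x"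
  using homeo by (auto simp: homeomorphism_def)

lemma metrically_proper_\<tau>: "metrically_proper \<tau>"
  by (rule homeomorphism_imp_metrically_proper[OF proper_b homeo])

lemma metrically_proper_\<tau>': "metrically_proper \<tau>'"
  by (rule homeomorphism_imp_metrically_proper[OF proper_a homeomorphism_symD[OF homeo]])

lemma constant_in_A: "(\<lambda>_. c) \<in> A"
  using A(1) constant_in_SO_bdd by blast

lemma image_slowly_oscillating: "f \<in> A \<Longrightarrow> slowly_oscillating (T f)"
  using bij B(2) by (auto simp: SO_def dest: bij_betwE)

lemma vanishes_near_image_iff:
  assumes "f \<in> A" "open U"
  shows "(\<forall>x\<in>U. f x = 0) \<longleftrightarrow> (\<forall>y\<in>\<tau> ` U. T f y = 0)"
  using order[OF \<open>f \<in> A\<close> constant_in_A[of 0] \<open>open U\<close>]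
    order[OF constant_in_A[of 0] \<open>f \<in> A\<close> \<open>open U\<close>]
  by (simp add: T_zero) (metis antisym order_refl)

text \<open>
  If \<open>T c \<ge> 1\<close> happened arbitrarily far out for each constant \<open>c > 0\<close>, then \<open>T\<close> would turn some
  function vanishing at infinity into one that jumps by \<open>1\<close> between points at distance at most
  \<open>r\<close>, arbitrarily far out.
\<close>
lemma image_of_small_constant_bounded:
  assumes "chain_connected TYPE('b)" "\<not> bounded (UNIV :: 'b set)"
  obtains c C where "c > 0" "C > 0" "\<And>y. T (\<lambda>_. c) y \<le> C"
proof -
  obtain r where r: "r > 0" "r_chain_connected TYPE('b) r"
    using assms(1) by (auto simp: chain_connected_def)
  \<comment> \<open>Any pair of base points serves to express that a sequence goes to infinity.\<close>
  define o1 :: 'a where "o1 = undefined"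
  define o2 where "o2 = \<tau> o1"
  have "\<exists>c>0. \<exists>R. \<forall>y. dist o2 y > R \<longrightarrow> T (\<lambda>_. c) y < 1"
  proof (rule ccontr)
    assume "\<not> ?thesis"
    then have large: "\<exists>y. dist o2 y > R \<and> T (\<lambda>_. c) y \<ge> 1" if "c > 0" for c R
      using that by (meson not_le)
    define P where "P n x w \<longleftrightarrow> T (\<lambda>_. 1 / (real n + 1)) (\<tau> x) \<ge> 1 \<and> w \<noteq> x \<and>
      dist (\<tau> x) (\<tau> w) \<le> r" for n x w
    have "\<exists>x w. P n x w \<and> dist o1 x > R \<and> dist o1 w > R" for n R
    proof -
      obtain D where D: "\<And>y. dist o1 (\<tau>' y) \<le> R \<Longrightarrow> dist o2 y \<le> D"
        using metrically_properE[OF metrically_proper_\<tau>'] by blast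
      obtain y where y: "dist o2 y > D + r" "T (\<lambda>_. 1 / (real n + 1)) y \<ge> 1"
        using large[of "1 / (real n + 1)"] by fastforce
      obtain z where z: "z \<noteq> y" "dist y z \<le> r"
        using chain_connected_neighbour[OF r(2) assms(2)] by blast
      have "dist o2 y \<le> dist o2 z + dist y z"
        by (rule dist_triangle2)
      then have "dist o2 y > D" "dist o2 z > D"
        using y(1) z(2) r(1) by auto
      then have "dist o1 (\<tau>' y) > R" "dist o1 (\<tau>' z) > R"
        using D by (meson not_le)+
      moreover have "P n (\<tau>' y) (\<tau>' z)"
        using y(2) z by (metis P_def \<tau>_\<tau>')
      ultimately show ?thesis by blast
    qed
    then obtain x w where xw: "\<And>n. P n (x n) (w n)" "\<And>n. dist o1 (x n) > real n"
      "\<And>m n. m \<noteq> n \<Longrightarrow> 2 * (real m + 1) + 1 \<le> dist (x m) (w n)"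
      using sparse_sequence_of_pairs[of P o1] by blast
    \<comment> \<open>Nothing bounds the distance of \<open>x n\<close> and \<open>w n\<close> from below, so these bumps may be very steep;
      they oscillate little because their heights tend to \<open>0\<close>.\<close>
    define L where "L n = min 1 (dist (x n) (w n) / 3)" for n
    have "\<exists>f\<in>SO_bdd. (\<forall>n. \<exists>U. open U \<and> x n \<in> U \<and> (\<forall>x\<in>U. f x \<ge> 1 / (real n + 1))) \<and>
      (\<forall>n. \<exists>U. open U \<and> w n \<in> U \<and> (\<forall>x\<in>U. f x = 0))"
    proof (rule separating_function[OF proper_a, where L = L and C = 1])
      show "L n > 0" for n
        using xw(1)[of n] by (auto simp: L_def P_def)
      show "3 * L n \<le> dist (x n) (w n)" for n by (simp add: L_def)
      show "2 * L m + 1 \<le> dist (x m) (w n)" if "m \<noteq> n" for m n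
        using xw(3)[OF that] by (simp add: L_def min_def split: if_splits)
      have "(\<lambda>n. 1 / (real n + 1)) \<longlonglongrightarrow> 0"
        using LIMSEQ_inverse_real_of_nat by (simp add: inverse_eq_divide add.commute)
      then show "(\<lambda>n. 1 / (real n + 1)) \<longlonglongrightarrow> 0 \<or> filterlim L at_top sequentially" ..
    qed auto
    then obtain f where f: "f \<in> SO_bdd"
      "\<And>n. \<exists>U. open U \<and> x n \<in> U \<and> (\<forall>x\<in>U. f x \<ge> 1 / (real n + 1))"
      "\<And>n. \<exists>U. open U \<and> w n \<in> U \<and> (\<forall>x\<in>U. f x = 0)"
      by blast
    have "f \<in> A" using f(1) A(1) by blast
    have high: "T f (\<tau> (x n)) \<ge> 1" for n
    proof -
      obtain U where "open U" "x n \<in> U" "\<forall>x\<in>U. f x \<ge> 1 / (real n + 1)"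
        using f(2) by blast
      then have "T f (\<tau> (x n)) \<ge> T (\<lambda>_. 1 / (real n + 1)) (\<tau> (x n))"
        using order[OF \<open>f \<in> A\<close> constant_in_A] by blast
      also have "T (\<lambda>_. 1 / (real n + 1)) (\<tau> (x n)) \<ge> 1"
        using xw(1) by (simp add: P_def)
      finally show ?thesis .
    qed
    have low: "T f (\<tau> (w n)) = 0" for n
      using f(3) vanishes_near_image_iff[OF \<open>f \<in> A\<close>] by blast
    obtain K where K: "compact K"
      "\<And>y y'. y \<notin> K \<Longrightarrow> dist y y' \<le> r \<Longrightarrow> \<bar>T f y - T f y'\<bar> < 1"
      using slowly_oscillatingE[OF proper_b image_slowly_oscillating[OF \<open>f \<in> A\<close>] r(1), of 1]
      by auto
    have "\<exists>n. \<tau> (x n) \<notin> K"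
    proof (rule sequence_to_infinity_leaves_compact[OF metrically_proper_\<tau>' _ _ K(1)])
      show "dist o1 (\<tau>' (\<tau> (x n))) > real n" for n using xw(2) by simp
      show "continuous_on UNIV \<tau>'" using homeo by (simp add: homeomorphism_def)
    qed
    then obtain n where "\<tau> (x n) \<notin> K" by blast
    moreover have "dist (\<tau> (x n)) (\<tau> (w n)) \<le> r"
      using xw(1) by (simp add: P_def)
    ultimately show False
      using K(2) high[of n] low[of n] by fastforce
  qed
  then obtain c R where c: "c > 0" "\<And>y. dist o2 y > R \<Longrightarrow> T (\<lambda>_. c) y < 1"
    by blast
  have "continuous_on (cball o2 R) (T (\<lambda>_. c))"
    using image_slowly_oscillating[OF constant_in_A[of c]] continuous_on_subset
    by (auto simp: slowly_oscillating_def)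
  then have "bounded (T (\<lambda>_. c) ` cball o2 R)"
    using proper_b by (intro compact_imp_bounded compact_continuous_image)
      (auto simp: proper_space_def)
  then obtain M where "\<forall>y\<in>cball o2 R. \<bar>T (\<lambda>_. c) y\<bar> \<le> M"
    by (auto simp: bounded_iff)
  then have M: "\<bar>T (\<lambda>_. c) y\<bar> \<le> M" if "dist o2 y \<le> R" for y
    using that by simp
  have "T (\<lambda>_. c) y \<le> max 1 M" for y
    using c(2)[of y] M[of y] by (cases "dist o2 y \<le> R") auto
  with c(1) show ?thesis by (intro that[of c "max 1 M"]) auto
qed

lemma uniformly_expansive_\<tau>:
  assumes "chain_connected TYPE('b)" "\<not> bounded (UNIV :: 'b set)"
  shows "uniformly_expansive \<tau>"
proof (rule uniformly_expansiveI, rule ccontr)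
  fix R0
  assume "\<nexists>M. \<forall>x x'. dist x x' \<le> R0 \<longrightarrow> dist (\<tau> x) (\<tau> x') \<le> M"
  then have spread0: "\<exists>x x'. dist x x' \<le> R0 \<and> dist (\<tau> x) (\<tau> x') > M" for M
    by (meson not_le)
  \<comment> \<open>Slow oscillation controls positive radii only.\<close>
  define R where "R = max 1 R0"
  have R: "R > 0" by (simp add: R_def)
  have spread: "\<exists>x x'. dist x x' \<le> R \<and> dist (\<tau> x) (\<tau> x') > M" for M
    using spread0[of M] unfolding R_def by (meson max.coboundedI2)
  \<comment> \<open>Any pair of base points serves to express that a sequence goes to infinity.\<close>
  define o1 :: 'a where "o1 = undefined"
  define o2 where "o2 = \<tau> o1"
  define P where "P n y y' \<longleftrightarrow> dist (\<tau>' y) (\<tau>' y') \<le> R \<and> dist y y' \<ge> 3 * (real n + 1)" for n y y'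
  have "\<exists>y y'. P n y y' \<and> dist o2 y > S \<and> dist o2 y' > S" for n S
  proof -
    obtain D where D: "\<And>x. dist o2 (\<tau> x) \<le> S \<Longrightarrow> dist o1 x \<le> D"
      using metrically_properE[OF metrically_proper_\<tau>] by blast
    obtain E where E: "\<And>y. dist o1 (\<tau>' y) \<le> D + R \<Longrightarrow> dist o2 y \<le> E"
      using metrically_properE[OF metrically_proper_\<tau>'] by blast
    obtain x x' where xx': "dist x x' \<le> R" "dist (\<tau> x) (\<tau> x') > max (2 * E) (3 * (real n + 1))"
      using spread by blast
    \<comment> \<open>If one of the two points were near \<open>o1\<close>, both would be, and their images would lie in a
      fixed ball.\<close>
    have not_both: "\<not> (dist o1 x \<le> D + R \<and> dist o1 x' \<le> D + R)"
    proof
      assume "dist o1 x \<le> D + R \<and> dist o1 x' \<le> D + R"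
      then have "dist o2 (\<tau> x) \<le> E" "dist o2 (\<tau> x') \<le> E" using E by auto
      then show False using xx'(2) dist_triangle3[of "\<tau> x" "\<tau> x'" o2] by auto
    qed
    have "\<not> dist o1 x \<le> D" "\<not> dist o1 x' \<le> D"
      using not_both xx'(1) R dist_triangle[of o1 x' x] dist_triangle2[of o1 x x'] by auto
    then have "dist o2 (\<tau> x) > S" "dist o2 (\<tau> x') > S"
      using D by (meson not_le)+
    moreover have "P n (\<tau> x) (\<tau> x')" using xx' by (simp add: P_def)
    ultimately show ?thesis by blast
  qed
  then obtain y y' where yy': "\<And>n. P n (y n) (y' n)" "\<And>n. dist o2 (y n) > real n"
    "\<And>m n. m \<noteq> n \<Longrightarrow> 2 * (real m + 1) + 1 \<le> dist (y m) (y' n)"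
    using sparse_sequence_of_pairs[of P o2] by blast
  obtain c C where c: "c > 0" "C > 0" "\<And>y. T (\<lambda>_. c) y \<le> C"
    using image_of_small_constant_bounded[OF assms] by blast
  have "\<exists>g\<in>SO_bdd. (\<forall>n. \<exists>V. open V \<and> y n \<in> V \<and> (\<forall>y\<in>V. g y \<ge> C)) \<and>
    (\<forall>n. \<exists>V. open V \<and> y' n \<in> V \<and> (\<forall>y\<in>V. g y = 0))"
  proof (rule separating_function[OF proper_b, where L = "\<lambda>n. real n + 1" and C = C])
    have "filterlim (\<lambda>n. 1 + real n) at_top sequentially"
      by (intro filterlim_tendsto_add_at_top[OF tendsto_const] filterlim_real_sequentially)
    then show "(\<lambda>_. C) \<longlonglongrightarrow> 0 \<or> filterlim (\<lambda>n. real n + 1) at_top sequentially"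
      by (simp add: add.commute)
    show "3 * (real n + 1) \<le> dist (y n) (y' n)" for n using yy'(1) by (simp add: P_def)
  qed (use c yy'(3) in auto)
  then obtain g where g: "g \<in> SO_bdd" "\<And>n. \<exists>V. open V \<and> y n \<in> V \<and> (\<forall>y\<in>V. g y \<ge> C)"
    "\<And>n. \<exists>V. open V \<and> y' n \<in> V \<and> (\<forall>y\<in>V. g y = 0)" by blast
  then obtain f where f: "f \<in> A" "T f = g"
    using bij B(1) by (auto simp: bij_betw_def)
  have open_img: "open (\<tau>' ` V)" and img: "\<tau> ` \<tau>' ` V = V" if "open V" for V
    using homeomorphism_imp_open_map[OF homeomorphism_symD[OF homeo], of V] that
    by (auto simp: image_image)
  have high: "f (\<tau>' (y n)) \<ge> c" for n
  proof -
    obtain V where V: "open V" "y n \<in> V" "\<forall>y\<in>V. g y \<ge> C"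
      using g(2) by blast
    then have "\<forall>y\<in>\<tau> ` \<tau>' ` V. T (\<lambda>_. c) y \<le> T f y"
      using c(3) f(2) img by (metis order_trans)
    then show ?thesis
      using order[OF f(1) constant_in_A open_img[OF V(1)]] V(2) by blast
  qed
  have low: "f (\<tau>' (y' n)) = 0" for n
  proof -
    obtain V where V: "open V" "y' n \<in> V" "\<forall>y\<in>V. g y = 0"
      using g(3) by blast
    then show ?thesis
      using vanishes_near_image_iff[OF f(1) open_img[OF V(1)]] f(2) img[OF V(1)] by auto
  qed
  have "slowly_oscillating f" using f(1) A(2) by (auto simp: SO_def)
  then obtain K where K: "compact K"
    "\<And>x x'. x \<notin> K \<Longrightarrow> dist x x' \<le> R \<Longrightarrow> \<bar>f x - f x'\<bar> < c"
    using slowly_oscillatingE[OF proper_a _ R c(1)] by blast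
  have "\<exists>n. \<tau>' (y n) \<notin> K"
  proof (rule sequence_to_infinity_leaves_compact[OF metrically_proper_\<tau> _ _ K(1)])
    show "dist o2 (\<tau> (\<tau>' (y n))) > real n" for n using yy'(2) by simp
    show "continuous_on UNIV \<tau>" using homeo by (simp add: homeomorphism_def)
  qed
  then obtain n where "\<tau>' (y n) \<notin> K" by blast
  moreover have "dist (\<tau>' (y n)) (\<tau>' (y' n)) \<le> R"
    using yy'(1) by (simp add: P_def)
  ultimately show False
    using K(2) high[of n] low[of n] by fastforce
qed

end

lemma induced_homeomorphism_imp_coarse:
  fixes A :: "('a::metric_space \<Rightarrow> real) set" and B :: "('b::metric_space \<Rightarrow> real) set"
  assumes X: "\<not> bounded (UNIV :: 'a set)" "chain_connected TYPE('a)" "proper_space TYPE('a)"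
    and Y: "\<not> bounded (UNIV :: 'b set)" "chain_connected TYPE('b)" "proper_space TYPE('b)"
    and A: "SO_bdd \<subseteq> A" "A \<subseteq> SO" and B: "SO_bdd \<subseteq> B" "B \<subseteq> SO"
    and T: "lattice_isomorphism A B T" "T (\<lambda>_. 0) = (\<lambda>_. 0)"
    and \<tau>: "induced_homeomorphism A T \<tau>"
  shows "coarse_homeomorphism \<tau>"
proof -
  interpret order_transport A B T \<tau> "inv \<tau>"
  proof
    show "bij_betw T A B" using T(1) by (simp add: lattice_isomorphism_def)
    show "homeomorphism UNIV UNIV \<tau> (inv \<tau>)" using \<tau> by (simp add: induced_homeomorphism_def)
    show "(\<forall>x\<in>U. g x \<le> f x) \<longleftrightarrow> (\<forall>y\<in>\<tau> ` U. T g y \<le> T f y)"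
      if "f \<in> A" "g \<in> A" "open U" for f g U
      using \<tau> that unfolding induced_homeomorphism_def by blast
  qed (fact A B T(2) X(3) Y(3))+
  interpret inverse: order_transport B A "the_inv_into A T" "inv \<tau>" \<tau>
    by (rule inverse)
  show ?thesis
    unfolding coarse_homeomorphism_def coarse_map_def
    using homeo uniformly_expansive_\<tau>[OF Y(2,1)] inverse.uniformly_expansive_\<tau>[OF X(2,1)]
      metrically_proper_\<tau> metrically_proper_\<tau>' by blast
qed

theorem theorem4p3:
  assumes "\<not> bounded (UNIV :: 'a::metric_space set)"
    and "chain_connected TYPE('a)"
    and "proper_space TYPE('a)"
    and "\<not> bounded (UNIV :: 'b::metric_space set)"
    and "chain_connected TYPE('b)"
    and "proper_space TYPE('b)"
  shows "(\<forall>(T :: ('a \<Rightarrow> real) \<Rightarrow> ('b \<Rightarrow> real)) (\<tau> :: 'a \<Rightarrow> 'b).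
            lattice_isomorphism SO SO T \<and> T (\<lambda>_. 0) = (\<lambda>_. 0) \<and> induced_homeomorphism SO T \<tau>
            \<longrightarrow> coarse_homeomorphism \<tau>) \<and>
         (\<forall>(T :: ('a \<Rightarrow> real) \<Rightarrow> ('b \<Rightarrow> real)) (\<tau> :: 'a \<Rightarrow> 'b).
            lattice_isomorphism SO_bdd SO_bdd T \<and> T (\<lambda>_. 0) = (\<lambda>_. 0) \<and>
            induced_homeomorphism SO_bdd T \<tau>
            \<longrightarrow> coarse_homeomorphism \<tau>)"
proof -
  have le: "SO_bdd \<subseteq> SO" by (auto simp: SO_bdd_def SO_def)
  show ?thesis
    using induced_homeomorphism_imp_coarse[OF assms le order_refl le order_refl]
      induced_homeomorphism_imp_coarse[OF assms order_refl le order_refl le] by blast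
qed

end
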